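(* Let $G$ be a locally compact and $\sigma$-compact group. Then $G$ is weakly Haagerup with constant $1$ (i.e. $\Lambda_{\mathrm{WH}}(G)=1$) if and only if there is a continuous, proper function $\psi:G\to[0,\infty)$ such that $\|e^{-t\psi}\|_{B_2}\le1$ for every $t>0$. Moreover, we can take $\psi$ to be symmetric, i.e. $\psi(g^{-1})=\psi(g)$ for all $g\in G$.
   Context: Let $G$ be a locally compact (Hausdorff) group. A continuous function $u:G\to\mathbb{C}$ is a Herz-Schur multiplier if for every bounded operator $[a_{xy}]_{x,y\in G}$ on $\ell^2(G)$ the matrix $[u(y^{-1}x)a_{xy}]$ represents a bounded operator on $\ell^2(G)$; $B_2(G)$ is the set of these and $\|u\|_{B_2}$ is the norm of the operator $[a_{xy}]\mapsto[u(y^{-1}x)a_{xy}]$ on $B(\ell^2(G))$; the condition $\|u\|_{B_2}\le1$ includes $u\in B_2(G)$. $\Lambda_{\mathrm{WH}}(G)$ is the infimum of those $C>0$ for which there is a net $(u_\alpha)$ in $B_2(G)\cap C_0(G)$ with $\|u_\alpha\|_{B_2}\le C$ for all $\alpha$ and $u_\alpha\to1$ uniformly on compact sets ($\infty$ if no such $C$ exists); the infimum is attained when finite, and it is always at least $1$. A continuous map is proper if preimages of compact sets are compact. *)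

theory Defs
  imports "HOL-Analysis.Analysis"
begin

text \<open>
  Locally compact groups are types of class \<open>topological_group_add\<close> that are Hausdorff and satisfy
  \<open>locally_compact_space euclidean\<close>. The group law is written additively because the library's
  topological groups are, but \<open>group_add\<close> does not assume commutativity: \<open>y\<^sup>-\<^sup>1x\<close> is \<open>- y + x\<close>.
\<close>

definition sigma_compact :: "'a::topological_space set \<Rightarrow> bool" where
  "sigma_compact S \<longleftrightarrow> (\<exists>K::nat \<Rightarrow> 'a set. (\<forall>n. compact (K n)) \<and> (\<Union>n. K n) = S)"

definition ell2 :: "('a \<Rightarrow> complex) set" where
  "ell2 = {\<xi>. (\<lambda>x. (cmod (\<xi> x))\<^sup>2) summable_on UNIV}"

definition ell2_norm :: "('a \<Rightarrow> complex) \<Rightarrow> real" where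
  "ell2_norm \<xi> = sqrt (\<Sum>\<^sub>\<infinity>x. (cmod (\<xi> x))\<^sup>2)"

definition delta :: "'a \<Rightarrow> 'a \<Rightarrow> complex" where
  "delta y x = (if x = y then 1 else 0)"

text \<open>
  An operator on \<open>\<ell>\<^sup>2\<close> is a function on all of \<open>'a \<Rightarrow> complex\<close> of which only the values on \<open>ell2\<close> matter.
\<close>

definition bounded_operator ::
    "(('a \<Rightarrow> complex) \<Rightarrow> ('a \<Rightarrow> complex)) \<Rightarrow> bool" where
  "bounded_operator T \<longleftrightarrow>
     (\<forall>\<xi>\<in>ell2. T \<xi> \<in> ell2) \<and>
     (\<forall>\<xi>\<in>ell2. \<forall>\<eta>\<in>ell2. T (\<lambda>x. \<xi> x + \<eta> x) = (\<lambda>x. T \<xi> x + T \<eta> x)) \<and>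
     (\<forall>c. \<forall>\<xi>\<in>ell2. T (\<lambda>x. c * \<xi> x) = (\<lambda>x. c * T \<xi> x)) \<and>
     (\<exists>C. \<forall>\<xi>\<in>ell2. ell2_norm (T \<xi>) \<le> C * ell2_norm \<xi>)"

definition operator_norm ::
    "(('a \<Rightarrow> complex) \<Rightarrow> ('a \<Rightarrow> complex)) \<Rightarrow> real" where
  "operator_norm T = (SUP \<xi>\<in>{\<xi>\<in>ell2. ell2_norm \<xi> \<le> 1}. ell2_norm (T \<xi>))"

text \<open>The \<open>(x, y)\<close> entry of the matrix of \<open>T\<close> is \<open>\<langle>T \<delta>\<^sub>y, \<delta>\<^sub>x\<rangle> = (T \<delta>\<^sub>y)(x)\<close>.\<close>

definition represents ::
    "('a \<Rightarrow> 'a \<Rightarrow> complex) \<Rightarrow> (('a \<Rightarrow> complex) \<Rightarrow> ('a \<Rightarrow> complex)) \<Rightarrow> bool" where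
  "represents a T \<longleftrightarrow> bounded_operator T \<and> (\<forall>x y. a x y = T (delta y) x)"

definition schur_product ::
    "('a::group_add \<Rightarrow> complex) \<Rightarrow> ('a \<Rightarrow> 'a \<Rightarrow> complex) \<Rightarrow> ('a \<Rightarrow> 'a \<Rightarrow> complex)" where
  "schur_product u a = (\<lambda>x y. u (- y + x) * a x y)"

definition B2 :: "('a::topological_group_add \<Rightarrow> complex) set" where
  "B2 = {u. continuous_on UNIV u \<and>
            (\<forall>a. (\<exists>T. represents a T) \<longrightarrow> (\<exists>S. represents (schur_product u a) S))}"

text \<open>
  The norm of \<open>[a\<^sub>x\<^sub>y] \<mapsto> [u(y\<^sup>-\<^sup>1x) a\<^sub>x\<^sub>y]\<close> as an operator on \<open>B(\<ell>\<^sup>2)\<close>. It is meaningful only for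
  \<open>u \<in> B2\<close>, so a norm bound is always stated together with membership in \<open>B2\<close>.
\<close>

definition B2_norm :: "('a::topological_group_add \<Rightarrow> complex) \<Rightarrow> ereal" where
  "B2_norm u =
     Sup {ereal (operator_norm S) | a T S.
            represents a T \<and> operator_norm T \<le> 1 \<and> represents (schur_product u a) S}"

definition C0 :: "('a::topological_space \<Rightarrow> complex) set" where
  "C0 = {u. continuous_on UNIV u \<and> (\<forall>e>0. \<exists>K. compact K \<and> (\<forall>x. x \<notin> K \<longrightarrow> cmod (u x) < e))}"

text \<open>
  The constants \<open>C\<close> in the definition of \<open>\<Lambda>\<^sub>W\<^sub>H\<close>. Following the library, nets are expressed by
  filters; \<open>WH_constantsI\<close> and \<open>WH_constantsE\<close> below show that this agrees with nets
  indexed by directed sets of arbitrary type.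
\<close>

definition WH_constants :: "'a::topological_group_add itself \<Rightarrow> real set" where
  "WH_constants _ =
     {C. C > 0 \<and>
        (\<exists>F :: ('a \<Rightarrow> complex) filter. F \<noteq> bot \<and>
           (\<forall>\<^sub>F u in F. u \<in> B2 \<inter> C0 \<and> B2_norm u \<le> ereal C) \<and>
           (\<forall>K. compact K \<longrightarrow> uniform_limit K (\<lambda>u. u) (\<lambda>_. 1) F))}"

text \<open>If there is no such \<open>C\<close>, the infimum is \<open>\<infinity>\<close>.\<close>

definition Lambda_WH :: "'a::topological_group_add itself \<Rightarrow> ereal" where
  "Lambda_WH G = Inf (ereal ` WH_constants G)"

definition proper_function :: "('a::topological_space \<Rightarrow> 'b::topological_space) \<Rightarrow> bool" where
  "proper_function f \<longleftrightarrow> (\<forall>K. compact K \<longrightarrow> compact (f -` K))"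

definition directed_set :: "'i set \<Rightarrow> ('i \<Rightarrow> 'i \<Rightarrow> bool) \<Rightarrow> bool" where
  "directed_set I le \<longleftrightarrow> I \<noteq> {} \<and> (\<forall>i\<in>I. le i i) \<and>
     (\<forall>i\<in>I. \<forall>j\<in>I. \<forall>k\<in>I. le i j \<longrightarrow> le j k \<longrightarrow> le i k) \<and>
     (\<forall>i\<in>I. \<forall>j\<in>I. \<exists>k\<in>I. le i k \<and> le j k)"

lemma WH_constantsI:
  fixes I :: "'i set" and u :: "'i \<Rightarrow> 'a::topological_group_add \<Rightarrow> complex"
  assumes "C > 0" and dir: "directed_set I le"
    and u: "\<And>i. i \<in> I \<Longrightarrow> u i \<in> B2 \<inter> C0 \<and> B2_norm (u i) \<le> ereal C"
    and lim: "\<And>K e. compact K \<Longrightarrow> e > 0 \<Longrightarrow>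
                \<exists>i\<in>I. \<forall>j\<in>I. le i j \<longrightarrow> (\<forall>x\<in>K. cmod (u j x - 1) < e)"
  shows "C \<in> WH_constants TYPE('a)"
proof -
  define N where "N = (INF i\<in>I. principal {j\<in>I. le i j})"
  have ev: "eventually P N \<longleftrightarrow> (\<exists>i\<in>I. \<forall>j\<in>I. le i j \<longrightarrow> P j)" for P
  proof -
    have "eventually P N \<longleftrightarrow> (\<exists>i\<in>I. eventually P (principal {j\<in>I. le i j}))"
      unfolding N_def
    proof (rule eventually_INF_base)
      show "I \<noteq> {}" using dir by (simp add: directed_set_def)
      fix i j assume ij: "i \<in> I" "j \<in> I"
      then obtain k where k: "k \<in> I" "le i k" "le j k"
        using dir unfolding directed_set_def by blast
      have "{l\<in>I. le k l} \<subseteq> {l\<in>I. le i l} \<inter> {l\<in>I. le j l}"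
        using dir ij k unfolding directed_set_def by blast
      then show "\<exists>k\<in>I. principal {l\<in>I. le k l} \<le>
          inf (principal {l\<in>I. le i l}) (principal {l\<in>I. le j l})"
        using k by auto
    qed
    then show ?thesis by (simp add: eventually_principal Ball_def Bex_def imp_conjL)
  qed
  define F where "F = filtermap u N"
  have "\<not> eventually (\<lambda>_. False) N"
    using dir unfolding ev directed_set_def by blast
  then have "F \<noteq> bot"
    by (simp add: F_def trivial_limit_def eventually_filtermap)
  moreover have "\<forall>\<^sub>F v in F. v \<in> B2 \<inter> C0 \<and> B2_norm v \<le> ereal C"
    using dir u unfolding F_def eventually_filtermap ev directed_set_def by blast
  moreover have "uniform_limit K (\<lambda>v. v) (\<lambda>_. 1) F" if "compact K" for K
    using lim[OF that] unfolding uniform_limit_iff F_def eventually_filtermap ev dist_norm by blast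
  ultimately show ?thesis
    using \<open>C > 0\<close> unfolding WH_constants_def by blast
qed

lemma WH_constantsE:
  assumes "C \<in> WH_constants TYPE('a::topological_group_add)"
  obtains I :: "('a::topological_group_add set \<times> nat) set" and le and u :: "'a::topological_group_add set \<times> nat \<Rightarrow> 'a::topological_group_add \<Rightarrow> complex"
  where "C > 0" "directed_set I le"
    "\<And>i. i \<in> I \<Longrightarrow> u i \<in> B2 \<inter> C0 \<and> B2_norm (u i) \<le> ereal C"
    "\<And>K e. compact K \<Longrightarrow> e > 0 \<Longrightarrow>
       \<exists>i\<in>I. \<forall>j\<in>I. le i j \<longrightarrow> (\<forall>x\<in>K. cmod (u j x - 1) < e)"
proof -
  obtain F :: "('a \<Rightarrow> complex) filter" where "C > 0" "F \<noteq> bot"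
    and F: "\<forall>\<^sub>F u in F. u \<in> B2 \<inter> C0 \<and> B2_norm u \<le> ereal C"
    and lim: "\<And>K. compact K \<Longrightarrow> uniform_limit K (\<lambda>u. u) (\<lambda>_. 1) F"
    using assms unfolding WH_constants_def by blast
  define I :: "('a set \<times> nat) set" where "I = {K. compact K} \<times> UNIV"
  define le :: "'a set \<times> nat \<Rightarrow> 'a set \<times> nat \<Rightarrow> bool"
    where "le i j \<longleftrightarrow> fst i \<subseteq> fst j \<and> snd i \<le> snd j" for i j
  have "\<exists>v. (v \<in> B2 \<inter> C0 \<and> B2_norm v \<le> ereal C) \<and>
            (\<forall>x\<in>fst i. cmod (v x - 1) < inverse (real (Suc (snd i))))" if "i \<in> I" for i
  proof -
    have "\<forall>\<^sub>F v in F. \<forall>x\<in>fst i. cmod (v x - 1) < inverse (real (Suc (snd i)))"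
      using lim[of "fst i"] that unfolding I_def uniform_limit_iff dist_norm
      by (auto dest!: spec[of _ "inverse (real (Suc (snd i)))"])
    from eventually_happens'[OF \<open>F \<noteq> bot\<close> eventually_conj[OF F this]] show ?thesis .
  qed
  then obtain u where u: "\<And>i. i \<in> I \<Longrightarrow> (u i \<in> B2 \<inter> C0 \<and> B2_norm (u i) \<le> ereal C) \<and>
            (\<forall>x\<in>fst i. cmod (u i x - 1) < inverse (real (Suc (snd i))))"
    by metis
  show thesis
  proof (rule that[OF \<open>C > 0\<close>])
    show "directed_set I le"
      unfolding directed_set_def
    proof (intro conjI ballI impI)
      show "I \<noteq> {}" by (auto simp: I_def)
      fix i j assume "i \<in> I" "j \<in> I"
      then show "\<exists>k\<in>I. le i k \<and> le j k"
        by (intro bexI[of _ "(fst i \<union> fst j, max (snd i) (snd j))"])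
           (auto simp: I_def le_def)
    qed (auto simp: le_def)
    show "u i \<in> B2 \<inter> C0 \<and> B2_norm (u i) \<le> ereal C" if "i \<in> I" for i
      using u[OF that] by blast
    fix K :: "'a set" and e :: real assume K: "compact K" and "e > 0"
    then obtain n where n: "inverse (real (Suc n)) < e" using reals_Archimedean by blast
    show "\<exists>i\<in>I. \<forall>j\<in>I. le i j \<longrightarrow> (\<forall>x\<in>K. cmod (u j x - 1) < e)"
    proof (intro bexI[of _ "(K, n)"] ballI impI)
      show "(K, n) \<in> I" using K by (simp add: I_def)
      fix j x assume j: "j \<in> I" "le (K, n) j" and "x \<in> K"
      then have "cmod (u j x - 1) < inverse (real (Suc (snd j)))"
        using u[of j] by (auto simp: le_def)
      also have "\<dots> \<le> inverse (real (Suc n))"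
        using j by (intro le_imp_inverse_le) (auto simp: le_def)
      also note n
      finally show "cmod (u j x - 1) < e" .
    qed
  qed
qed

end

theory Submission
  imports Defs
begin

text \<open>
  A matrix represents an operator of norm at most \<open>M\<close> iff all its finite truncations are bounded by
  \<open>M\<close>, so the functions \<open>u\<close> with \<open>\<parallel>u\<parallel>\<^bsub>B\<^sub>2\<^esub> \<le> 1\<close>, continuity aside, form a convex set closed under
  products, conjugation, inversion of the argument and pointwise limits. In particular, with a
  real-valued \<open>v\<close> it contains \<open>exp (- t (1 - v))\<close>, the limit of \<open>((1 - t/n) + (t/n) v)\<^sup>n\<close>. If \<open>\<Lambda>\<^sub>W\<^sub>H = 1\<close>,
  rescaling the approximating net yields symmetric \<open>v\<^sub>n \<in> C\<^sub>0\<close> of this kind with values in \<open>[0, 1]\<close> and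
  \<open>1 - v\<^sub>n < 2\<^sup>-\<^sup>n\<close> on the \<open>n\<close>-th set of a compact exhaustion; then \<open>\<psi> = \<Sum>\<^sub>n (1 - v\<^sub>n)\<close> converges locally
  uniformly, and is proper because each \<open>1 - v\<^sub>n\<close> exceeds \<open>1/2\<close> off a compact set.
  Conversely, the functions \<open>exp (- \<psi> / n)\<close> show \<open>\<Lambda>\<^sub>W\<^sub>H \<le> 1\<close>.
\<close>

subsection \<open>Bounded operators on \<open>\<ell>\<^sup>2\<close> and their matrices\<close>

lemma ell2_normI:
  assumes "\<And>F. finite F \<Longrightarrow> L2_set (\<lambda>x. cmod (\<xi> x)) F \<le> B"
  shows "\<xi> \<in> ell2" and "ell2_norm \<xi> \<le> B"
proof -
  \<comment> \<open>The empty set forces \<open>B\<close> to be nonnegative, so that bounds by the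
    square of \<open>B\<close> can be turned back into bounds by \<open>B\<close>.\<close>
  have B: "B \<ge> 0"
    using assms[of "{}"] by simp
  have le: "(\<Sum>x\<in>F. (cmod (\<xi> x))\<^sup>2) \<le> B\<^sup>2" if "finite F" for F
    using assms[OF that] unfolding L2_set_def
    by (simp add: sqrt_le_D)
  have s: "(\<lambda>x. (cmod (\<xi> x))\<^sup>2) summable_on UNIV"
    by (rule nonneg_bdd_above_summable_on) (auto intro!: bdd_aboveI[of _ "B\<^sup>2"] le)
  then show "\<xi> \<in> ell2"
    by (simp add: ell2_def)
  have "(\<Sum>\<^sub>\<infinity>x. (cmod (\<xi> x))\<^sup>2) \<le> B\<^sup>2"
    using s le by (rule infsum_le_finite_sums)
  then show "ell2_norm \<xi> \<le> B"
    unfolding ell2_norm_def using B real_le_lsqrt by blast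
qed

lemma L2_set_le_ell2_norm:
  assumes "\<xi> \<in> ell2" "finite F"
  shows "L2_set (\<lambda>x. cmod (\<xi> x)) F \<le> ell2_norm \<xi>"
  using assms unfolding L2_set_def ell2_norm_def ell2_def
  by (auto intro!: finite_sum_le_infsum)

lemma cmod_le_ell2_norm: "\<xi> \<in> ell2 \<Longrightarrow> cmod (\<xi> x) \<le> ell2_norm \<xi>"
  using L2_set_le_ell2_norm[of \<xi> "{x}"] by simp

lemma ell2_norm_nonneg [simp]: "ell2_norm \<xi> \<ge> 0"
  by (simp add: ell2_norm_def infsum_nonneg)

lemma ell2_add:
  assumes "\<xi> \<in> ell2" "\<eta> \<in> ell2"
  shows "(\<lambda>x. \<xi> x + \<eta> x) \<in> ell2"
proof (rule ell2_normI)
  fix F :: "'a set" assume "finite F"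
  have "L2_set (\<lambda>x. cmod (\<xi> x + \<eta> x)) F \<le> L2_set (\<lambda>x. cmod (\<xi> x) + cmod (\<eta> x)) F"
    by (intro L2_set_mono norm_triangle_ineq) auto
  also have "\<dots> \<le> L2_set (\<lambda>x. cmod (\<xi> x)) F + L2_set (\<lambda>x. cmod (\<eta> x)) F"
    by (rule L2_set_triangle_ineq)
  also have "\<dots> \<le> ell2_norm \<xi> + ell2_norm \<eta>"
    using assms \<open>finite F\<close> by (intro add_mono L2_set_le_ell2_norm)
  finally show "L2_set (\<lambda>x. cmod (\<xi> x + \<eta> x)) F \<le> ell2_norm \<xi> + ell2_norm \<eta>" .
qed

lemma
  assumes "\<xi> \<in> ell2"
  shows ell2_cmult: "(\<lambda>x. c * \<xi> x) \<in> ell2"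
    and ell2_norm_cmult_le: "ell2_norm (\<lambda>x. c * \<xi> x) \<le> cmod c * ell2_norm \<xi>"
proof -
  have *: "L2_set (\<lambda>x. cmod (c * \<xi> x)) F \<le> cmod c * ell2_norm \<xi>" if "finite F" for F
    using assms that
    by (simp add: norm_mult L2_set_right_distrib[symmetric] L2_set_le_ell2_norm mult_left_mono)
  show "(\<lambda>x. c * \<xi> x) \<in> ell2" "ell2_norm (\<lambda>x. c * \<xi> x) \<le> cmod c * ell2_norm \<xi>"
    by (rule ell2_normI[OF *]; simp)+
qed

text \<open>Cutting off outside a finite set gives the finitely supported vectors: a bounded
  operator acts on them through finite sums of matrix entries, and they are dense in
  \<open>ell2\<close>.\<close>

definition truncate :: "('a \<Rightarrow> complex) \<Rightarrow> 'a set \<Rightarrow> 'a \<Rightarrow> complex" where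
  "truncate \<xi> F = (\<lambda>x. if x \<in> F then \<xi> x else 0)"

lemma
  assumes "finite F"
  shows truncate_ell2: "truncate \<xi> F \<in> ell2"
    and ell2_norm_truncate: "ell2_norm (truncate \<xi> F) = L2_set (\<lambda>x. cmod (\<xi> x)) F"
proof -
  have eq: "(\<lambda>x. (cmod (truncate \<xi> F x))\<^sup>2) = (\<lambda>x. if x \<in> F then (cmod (\<xi> x))\<^sup>2 else 0)"
    by (auto simp: truncate_def)
  have "(\<lambda>x. if x \<in> F then (cmod (\<xi> x))\<^sup>2 else 0) summable_on UNIV \<longleftrightarrow>
      (\<lambda>x. (cmod (\<xi> x))\<^sup>2) summable_on F"
    by (rule summable_on_cong_neutral) auto
  then show "truncate \<xi> F \<in> ell2"
    using assms by (simp add: ell2_def eq)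
  have "(\<Sum>\<^sub>\<infinity>x. if x \<in> F then (cmod (\<xi> x))\<^sup>2 else 0) = (\<Sum>\<^sub>\<infinity>x\<in>F. (cmod (\<xi> x))\<^sup>2)"
    by (rule infsum_cong_neutral) auto
  then show "ell2_norm (truncate \<xi> F) = L2_set (\<lambda>x. cmod (\<xi> x)) F"
    unfolding ell2_norm_def L2_set_def eq using assms by simp
qed

lemma delta_ell2: "delta y \<in> ell2"
proof -
  have "delta y = truncate (\<lambda>_. 1) {y}"
    by (auto simp: delta_def truncate_def fun_eq_iff)
  then show ?thesis
    by (simp add: truncate_ell2)
qed

text \<open>The squared norm of the tail is the full sum minus a finite partial sum. The difference
  is written with a factor \<open>-1\<close> so that \<open>ell2_add\<close> and
  \<open>ell2_cmult\<close> apply to it directly.\<close>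

lemma ell2_norm_diff_truncate_tendsto:
  assumes "\<xi> \<in> ell2"
  shows "((\<lambda>F. ell2_norm (\<lambda>x. \<xi> x + (-1) * truncate \<xi> F x)) \<longlongrightarrow> 0) (finite_subsets_at_top UNIV)"
proof -
  define f where "f = (\<lambda>x. (cmod (\<xi> x))\<^sup>2)"
  have f: "f summable_on UNIV"
    using assms by (simp add: ell2_def f_def)
  have "((\<lambda>F. sqrt (infsum f UNIV - sum f F)) \<longlongrightarrow> sqrt (infsum f UNIV - infsum f UNIV))
      (finite_subsets_at_top UNIV)"
    by (intro tendsto_intros infsum_tendsto f)
  then have lim: "((\<lambda>F. sqrt (infsum f UNIV - sum f F)) \<longlongrightarrow> 0) (finite_subsets_at_top UNIV)"
    by simp
  have "sqrt (infsum f UNIV - sum f F) = ell2_norm (\<lambda>x. \<xi> x + (-1) * truncate \<xi> F x)"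
    if "finite F" for F
  proof -
    have "(\<Sum>\<^sub>\<infinity>x. (cmod (\<xi> x + (-1) * truncate \<xi> F x))\<^sup>2) = infsum f (UNIV - F)"
      by (rule infsum_cong_neutral) (auto simp: f_def truncate_def)
    also have "\<dots> = infsum f UNIV - infsum f F"
      by (intro infsum_Diff f) (use that in auto)
    finally show ?thesis
      using that by (simp add: ell2_norm_def)
  qed
  then have "\<forall>\<^sub>F F in finite_subsets_at_top UNIV.
      sqrt (infsum f UNIV - sum f F) = ell2_norm (\<lambda>x. \<xi> x + (-1) * truncate \<xi> F x)"
    by (intro eventually_finite_subsets_at_top_weakI) auto
  then show ?thesis
    using lim by (rule Lim_transform_eventually[rotated])
qed

section \<open>Bounded operators and the operator norm\<close>

lemma bounded_operatorD:
  assumes "bounded_operator T" "\<xi> \<in> ell2"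
  shows "T \<xi> \<in> ell2"
    and "\<eta> \<in> ell2 \<Longrightarrow> T (\<lambda>x. \<xi> x + \<eta> x) = (\<lambda>x. T \<xi> x + T \<eta> x)"
    and "T (\<lambda>x. c * \<xi> x) = (\<lambda>x. c * T \<xi> x)"
  using assms by (simp_all add: bounded_operator_def)

lemma bounded_operator_truncate:
  assumes T: "bounded_operator T" and "finite F"
  shows "T (truncate \<xi> F) = (\<lambda>x. \<Sum>y\<in>F. \<xi> y * T (delta y) x)"
  using \<open>finite F\<close>
proof (induction F)
  case empty
  \<comment> \<open>The zero vector is written as 0 times a unit vector, with an arbitrary index, so
    that homogeneity yields \<open>T 0 = 0\<close>.\<close>
  have "T (\<lambda>x. 0 * delta undefined x) = (\<lambda>x. 0 * T (delta undefined) x)"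
    by (rule bounded_operatorD[OF T delta_ell2])
  then show ?case
    by (simp add: truncate_def)
next
  case (insert z F)
  have "truncate \<xi> (insert z F) = (\<lambda>x. \<xi> z * delta z x + truncate \<xi> F x)"
    using insert by (auto simp: truncate_def delta_def fun_eq_iff)
  then have "T (truncate \<xi> (insert z F)) = (\<lambda>x. T (\<lambda>x. \<xi> z * delta z x) x + T (truncate \<xi> F) x)"
    using insert by (simp only: bounded_operatorD(2)[OF T ell2_cmult[OF delta_ell2] truncate_ell2])
  also have "T (\<lambda>x. \<xi> z * delta z x) = (\<lambda>x. \<xi> z * T (delta z) x)"
    by (rule bounded_operatorD[OF T delta_ell2])
  finally show ?case
    using insert by simp
qed

text \<open>\<open>operator_norm\<close> is a real supremum, so the values on the unit ball must
  first be shown bounded above; normalizing \<xi> then gives the estimate.\<close>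

lemma operator_norm_bound:
  assumes T: "bounded_operator T" and \<xi>: "\<xi> \<in> ell2"
  shows "ell2_norm (T \<xi>) \<le> operator_norm T * ell2_norm \<xi>"
proof -
  obtain C where C: "\<And>\<xi>. \<xi> \<in> ell2 \<Longrightarrow> ell2_norm (T \<xi>) \<le> C * ell2_norm \<xi>"
    using T unfolding bounded_operator_def by blast
  have bdd: "bdd_above ((\<lambda>\<xi>. ell2_norm (T \<xi>)) ` {\<xi>\<in>ell2. ell2_norm \<xi> \<le> 1})"
  proof (rule bdd_aboveI2)
    fix \<xi> :: "'a \<Rightarrow> complex" assume "\<xi> \<in> {\<xi>\<in>ell2. ell2_norm \<xi> \<le> 1}"
    then have "\<xi> \<in> ell2" "ell2_norm \<xi> \<le> 1" by auto
    have "ell2_norm (T \<xi>) \<le> C * ell2_norm \<xi>" by (rule C) fact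
    \<comment> \<open>The constant \<open>C\<close> comes without a sign, hence the absolute
      value.\<close>
    also have "\<dots> \<le> \<bar>C\<bar> * 1"
      using \<open>ell2_norm \<xi> \<le> 1\<close> by (intro mult_mono) auto
    finally show "ell2_norm (T \<xi>) \<le> \<bar>C\<bar>" by simp
  qed
  show ?thesis
  \<comment> \<open>A vector of norm zero cannot be normalized; there the raw bound with
    \<open>C\<close> already gives zero.\<close>
  proof (cases "ell2_norm \<xi> = 0")
    case True
    then show ?thesis using C[OF \<xi>] by simp
  next
    case False
    define r where "r = ell2_norm \<xi>"
    have r: "r > 0" using False by (simp add: r_def less_le)
    define \<eta> where "\<eta> = (\<lambda>x. complex_of_real (1 / r) * \<xi> x)"
    have "ell2_norm \<eta> \<le> cmod (complex_of_real (1 / r)) * ell2_norm \<xi>"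
      unfolding \<eta>_def by (rule ell2_norm_cmult_le[OF \<xi>])
    also have "\<dots> = 1" using r unfolding norm_of_real by (simp add: r_def)
    finally have \<eta>1: "ell2_norm \<eta> \<le> 1" .
    have \<eta>: "\<eta> \<in> ell2"
      unfolding \<eta>_def by (rule ell2_cmult[OF \<xi>])
    have "\<xi> = (\<lambda>x. complex_of_real r * \<eta> x)"
      using r by (simp add: \<eta>_def)
    then have "T \<xi> = (\<lambda>x. complex_of_real r * T \<eta> x)"
      using bounded_operatorD(3)[OF T \<eta>, of "complex_of_real r"] by simp
    then have "ell2_norm (T \<xi>) \<le> cmod (complex_of_real r) * ell2_norm (T \<eta>)"
      using ell2_norm_cmult_le[OF bounded_operatorD(1)[OF T \<eta>], of "complex_of_real r"] by simp
    also have "\<dots> = r * ell2_norm (T \<eta>)"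
      using r by simp
    also have "ell2_norm (T \<eta>) \<le> operator_norm T"
      unfolding operator_norm_def using \<eta> \<eta>1 by (intro cSUP_upper bdd) auto
    finally show ?thesis
      using r by (simp add: r_def mult.commute)
  qed
qed

section \<open>Operator bounds tested on finite blocks of a matrix\<close>

text \<open>Every finite block, with rows in \<open>E\<close> and columns in \<open>F\<close>, has
  norm at most \<open>M\<close>. Only finite sums occur, so algebraic operations and entrywise
  limits can be treated without convergence questions.\<close>

definition matrix_bound :: "real \<Rightarrow> ('a \<Rightarrow> 'a \<Rightarrow> complex) \<Rightarrow> bool" where
  "matrix_bound M a \<longleftrightarrow> (\<forall>E F \<xi>. finite E \<longrightarrow> finite F \<longrightarrow>
     L2_set (\<lambda>x. cmod (\<Sum>y\<in>F. \<xi> y * a x y)) E \<le> M * L2_set (\<lambda>y. cmod (\<xi> y)) F)"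

lemma matrix_boundI:
  assumes "\<And>E F \<xi>. finite E \<Longrightarrow> finite F \<Longrightarrow>
     L2_set (\<lambda>x. cmod (\<Sum>y\<in>F. \<xi> y * a x y)) E \<le> M * L2_set (\<lambda>y. cmod (\<xi> y)) F"
  shows "matrix_bound M a"
  using assms unfolding matrix_bound_def by blast

lemma matrix_boundD:
  assumes "matrix_bound M a" "finite E" "finite F"
  shows "L2_set (\<lambda>x. cmod (\<Sum>y\<in>F. \<xi> y * a x y)) E \<le> M * L2_set (\<lambda>y. cmod (\<xi> y)) F"
  using assms unfolding matrix_bound_def by blast

lemma matrix_bound_entry: "matrix_bound M a \<Longrightarrow> cmod (a x y) \<le> M"
  using matrix_boundD[of M a "{x}" "{y}" "\<lambda>_. 1"] by simp

lemma matrix_bound_nonneg: "matrix_bound M a \<Longrightarrow> M \<ge> 0"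
  using matrix_bound_entry[of M a undefined undefined] norm_ge_zero order_trans by blast

text \<open>A finite block sum is a coordinate of \<open>T\<close> applied to a truncated vector;
  restricting the coordinates to \<open>E\<close> only lowers the norm.\<close>

lemma matrix_bound_representation:
  assumes "represents a T"
  shows "matrix_bound (operator_norm T) a"
proof (rule matrix_boundI)
  fix E F :: "'a set" and \<xi> :: "'a \<Rightarrow> complex"
  assume fin: "finite E" "finite F"
  have T: "bounded_operator T" and a: "\<And>x y. a x y = T (delta y) x"
    using assms unfolding represents_def by blast+
  have "L2_set (\<lambda>x. cmod (\<Sum>y\<in>F. \<xi> y * a x y)) E = L2_set (\<lambda>x. cmod (T (truncate \<xi> F) x)) E"
    by (simp add: bounded_operator_truncate[OF T fin(2)] a)
  also have "\<dots> \<le> ell2_norm (T (truncate \<xi> F))"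
    by (intro L2_set_le_ell2_norm bounded_operatorD(1)[OF T] truncate_ell2 fin)
  also have "\<dots> \<le> operator_norm T * L2_set (\<lambda>y. cmod (\<xi> y)) F"
    using operator_norm_bound[OF T truncate_ell2[OF fin(2), of \<xi>]] fin
    by (simp add: ell2_norm_truncate)
  finally show "L2_set (\<lambda>x. cmod (\<Sum>y\<in>F. \<xi> y * a x y)) E
      \<le> operator_norm T * L2_set (\<lambda>y. cmod (\<xi> y)) F" .
qed

text \<open>For fixed finite \<open>E\<close> the block inequality survives the limit over
  \<open>F\<close>, and then \<open>ell2_normI\<close> lets \<open>E\<close> vary. Convergence is a
  hypothesis so that \<eta> can be either the image under a given operator or an image defined by
  infinite sums.\<close>

lemma matrix_bound_limit:
  assumes a: "matrix_bound M a" and \<xi>: "\<xi> \<in> ell2"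
    and lim: "\<And>x. ((\<lambda>F. \<Sum>y\<in>F. \<xi> y * a x y) \<longlongrightarrow> \<eta> x) (finite_subsets_at_top UNIV)"
  shows "\<eta> \<in> ell2" and "ell2_norm \<eta> \<le> M * ell2_norm \<xi>"
proof -
  have *: "L2_set (\<lambda>x. cmod (\<eta> x)) E \<le> M * ell2_norm \<xi>" if "finite E" for E
  proof (rule tendsto_upperbound)
    show "((\<lambda>F. L2_set (\<lambda>x. cmod (\<Sum>y\<in>F. \<xi> y * a x y)) E) \<longlongrightarrow> L2_set (\<lambda>x. cmod (\<eta> x)) E)
        (finite_subsets_at_top UNIV)"
      unfolding L2_set_def by (intro tendsto_intros lim)
    show "\<forall>\<^sub>F F in finite_subsets_at_top UNIV.
        L2_set (\<lambda>x. cmod (\<Sum>y\<in>F. \<xi> y * a x y)) E \<le> M * ell2_norm \<xi>"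
    proof (intro eventually_finite_subsets_at_top_weakI)
      fix F :: "'a set" assume "finite F"
      have "L2_set (\<lambda>x. cmod (\<Sum>y\<in>F. \<xi> y * a x y)) E \<le> M * L2_set (\<lambda>y. cmod (\<xi> y)) F"
        using a that \<open>finite F\<close> by (rule matrix_boundD)
      also have "\<dots> \<le> M * ell2_norm \<xi>"
        using matrix_bound_nonneg[OF a] \<xi> \<open>finite F\<close>
        by (intro mult_left_mono L2_set_le_ell2_norm)
      finally show "L2_set (\<lambda>x. cmod (\<Sum>y\<in>F. \<xi> y * a x y)) E \<le> M * ell2_norm \<xi>" .
    qed
  qed simp
  show "\<eta> \<in> ell2" "ell2_norm \<eta> \<le> M * ell2_norm \<xi>"
    by (rule ell2_normI[OF *]; simp)+
qed

text \<open>Since \<open>T\<close> is continuous and truncations are dense, each coordinate of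
  \<open>T \<xi>\<close> is the limit of its partial matrix sums, so
  \<open>matrix_bound_limit\<close> applies.\<close>

lemma operator_norm_le:
  assumes rep: "represents a T" and a: "matrix_bound M a"
  shows "operator_norm T \<le> M"
  unfolding operator_norm_def
proof (rule cSUP_least)
  show "{\<xi> \<in> ell2. ell2_norm \<xi> \<le> 1} \<noteq> ({} :: ('a \<Rightarrow> complex) set)"
    \<comment> \<open>The zero vector, as a truncation to the empty set, shows that the unit ball is
      nonempty.\<close>
    using truncate_ell2[of "{}" "\<lambda>_::'a. 0"] ell2_norm_truncate[of "{}" "\<lambda>_::'a. 0"] by auto
next
  fix \<xi> :: "'a \<Rightarrow> complex" assume "\<xi> \<in> {\<xi> \<in> ell2. ell2_norm \<xi> \<le> 1}"
  then have \<xi>: "\<xi> \<in> ell2" "ell2_norm \<xi> \<le> 1" by auto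
  have T: "bounded_operator T" and aT: "\<And>x y. a x y = T (delta y) x"
    using rep unfolding represents_def by blast+
  define \<zeta> where "\<zeta> F = (\<lambda>x. \<xi> x + (-1) * truncate \<xi> F x)" for F
  have \<zeta>: "\<zeta> F \<in> ell2" if "finite F" for F
    unfolding \<zeta>_def by (intro ell2_add ell2_cmult truncate_ell2 \<xi> that)
  have split: "T \<xi> x = T (truncate \<xi> F) x + T (\<zeta> F) x" if "finite F" for F x
  proof -
    have "\<xi> = (\<lambda>x. truncate \<xi> F x + \<zeta> F x)"
      by (simp add: \<zeta>_def)
    then show ?thesis
      using T truncate_ell2[OF that, of \<xi>] \<zeta>[OF that] unfolding bounded_operator_def by metis
  qed
  have "((\<lambda>F. \<Sum>y\<in>F. \<xi> y * a x y) \<longlongrightarrow> T \<xi> x) (finite_subsets_at_top UNIV)" for x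
  \<comment> \<open>The partial sum over \<open>F\<close> differs from the coordinate of
    \<open>T \<xi>\<close> by that of \<open>- T (\<zeta> F)\<close>, which is dominated by
    \<open>operator_norm T\<close> times the norm of the tail.\<close>
  proof (rule Lim_null_comparison[THEN Lim_transform_eventually[THEN LIM_zero_cancel]])
    show "((\<lambda>F. operator_norm T * ell2_norm (\<zeta> F)) \<longlongrightarrow> 0) (finite_subsets_at_top UNIV)"
      unfolding \<zeta>_def by (rule tendsto_mult_right_zero ell2_norm_diff_truncate_tendsto[OF \<xi>(1)])+
    show "\<forall>\<^sub>F F in finite_subsets_at_top UNIV. norm (- T (\<zeta> F) x) \<le> operator_norm T * ell2_norm (\<zeta> F)"
    proof (intro eventually_finite_subsets_at_top_weakI)
      fix F :: "'a set" assume F: "finite F"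
      have "T (\<zeta> F) \<in> ell2"
        by (rule bounded_operatorD(1)[OF T \<zeta>[OF F]])
      then have "cmod (T (\<zeta> F) x) \<le> ell2_norm (T (\<zeta> F))"
        by (rule cmod_le_ell2_norm)
      also have "\<dots> \<le> operator_norm T * ell2_norm (\<zeta> F)"
        by (rule operator_norm_bound[OF T \<zeta>[OF F]])
      finally show "norm (- T (\<zeta> F) x) \<le> operator_norm T * ell2_norm (\<zeta> F)" by simp
    qed
    show "\<forall>\<^sub>F F in finite_subsets_at_top UNIV. - T (\<zeta> F) x = (\<Sum>y\<in>F. \<xi> y * a x y) - T \<xi> x"
      by (intro eventually_finite_subsets_at_top_weakI)
         (simp add: split bounded_operator_truncate[OF T] aT)
  qed
  then have "ell2_norm (T \<xi>) \<le> M * ell2_norm \<xi>"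
    by (rule matrix_bound_limit[OF a \<xi>(1)])
  also have "\<dots> \<le> M"
    using \<xi> matrix_bound_nonneg[OF a] by (simp add: mult_left_le)
  finally show "ell2_norm (T \<xi>) \<le> M" .
qed

text \<open>Absolute summability comes from the one-row block at \<open>x\<close>: changing the
  phases of \<xi> turns every term into its modulus without increasing the norm of \<xi>.\<close>

lemma matrix_bound_summable:
  assumes a: "matrix_bound M a" and \<xi>: "\<xi> \<in> ell2"
  shows "(\<lambda>y. \<xi> y * a x y) summable_on UNIV"
proof (rule abs_summable_summable, rule nonneg_bdd_above_summable_on, simp, rule bdd_aboveI2)
  fix F :: "'a set" assume "F \<in> {F. F \<subseteq> UNIV \<and> finite F}"
  then have F: "finite F" by simp
  define s where "s y = cnj (sgn (\<xi> y * a x y))" for y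
  have s: "cmod (s y) \<le> 1" for y
    by (simp add: s_def norm_sgn)
  have "\<xi> y * s y * a x y = complex_of_real (cmod (\<xi> y * a x y))" for y
  proof -
    have "z * cnj (sgn z) = complex_of_real (cmod z)" for z
      using complex_norm_square[of z] by (simp add: sgn_eq power2_eq_square divide_simps)
    from this[of "\<xi> y * a x y"] show ?thesis
      by (simp add: s_def mult_ac)
  qed
  then have "(\<Sum>y\<in>F. \<xi> y * s y * a x y) = complex_of_real (\<Sum>y\<in>F. cmod (\<xi> y * a x y))"
    by simp
  then have "(\<Sum>y\<in>F. cmod (\<xi> y * a x y)) = cmod (\<Sum>y\<in>F. \<xi> y * s y * a x y)"
    by (simp only: norm_of_real) (simp add: sum_nonneg)
  also have "\<dots> \<le> M * L2_set (\<lambda>y. cmod (\<xi> y * s y)) F"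
    using matrix_boundD[OF a, of "{x}" F "\<lambda>y. \<xi> y * s y"] F by simp
  also have "\<dots> \<le> M * L2_set (\<lambda>y. cmod (\<xi> y)) F"
    using s by (intro mult_left_mono L2_set_mono matrix_bound_nonneg[OF a])
      (auto simp: norm_mult mult_left_le)
  also have "\<dots> \<le> M * ell2_norm \<xi>"
    by (intro mult_left_mono L2_set_le_ell2_norm matrix_bound_nonneg[OF a] \<xi> F)
  finally show "(\<Sum>y\<in>F. cmod (\<xi> y * a x y)) \<le> M * ell2_norm \<xi>" .
qed

text \<open>The converse of \<open>matrix_bound_representation\<close>: the operator is defined row
  by row through the convergent sums, and \<open>matrix_bound_limit\<close> bounds it.\<close>

lemma matrix_bound_represents:
  assumes a: "matrix_bound M a"
  shows "\<exists>T. represents a T"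
proof -
  define T where "T \<xi> = (\<lambda>x. \<Sum>\<^sub>\<infinity>y. \<xi> y * a x y)" for \<xi>
  note s = matrix_bound_summable[OF a]
  have lim: "((\<lambda>F. \<Sum>y\<in>F. \<xi> y * a x y) \<longlongrightarrow> T \<xi> x) (finite_subsets_at_top UNIV)"
    if "\<xi> \<in> ell2" for \<xi> x
    unfolding T_def by (rule infsum_tendsto[OF s[OF that]])
  have "bounded_operator T"
    unfolding bounded_operator_def
  proof (intro conjI ballI allI exI)
    fix \<xi> :: "'a \<Rightarrow> complex" assume \<xi>: "\<xi> \<in> ell2"
    show "T \<xi> \<in> ell2" "ell2_norm (T \<xi>) \<le> M * ell2_norm \<xi>"
      by (rule matrix_bound_limit[OF a \<xi> lim[OF \<xi>]])+
    show "T (\<lambda>x. c * \<xi> x) = (\<lambda>x. c * T \<xi> x)" for c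
      unfolding T_def mult.assoc by (subst infsum_cmult_right) (use s[OF \<xi>] in auto)
    fix \<eta> :: "'a \<Rightarrow> complex" assume \<eta>: "\<eta> \<in> ell2"
    show "T (\<lambda>x. \<xi> x + \<eta> x) = (\<lambda>x. T \<xi> x + T \<eta> x)"
      unfolding T_def distrib_right by (subst infsum_add) (use s \<xi> \<eta> in auto)
  qed
  moreover have "a x y = T (delta y) x" for x y
  proof -
    have "T (delta y) x = (\<Sum>\<^sub>\<infinity>z\<in>{y}. a x z)"
      unfolding T_def by (rule infsum_cong_neutral) (auto simp: delta_def)
    then show ?thesis by simp
  qed
  ultimately show ?thesis
    unfolding represents_def by blast
qed

section \<open>Operations and limits that respect block bounds\<close>

lemma matrix_bound_mono: "matrix_bound M a \<Longrightarrow> M \<le> N \<Longrightarrow> matrix_bound N a"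
  by (meson L2_set_nonneg matrix_boundD matrix_boundI mult_right_mono order_trans)

lemma matrix_bound_cmult:
  assumes "matrix_bound M a"
  shows "matrix_bound (cmod c * M) (\<lambda>x y. c * a x y)"
proof (rule matrix_boundI)
  fix E F :: "'a set" and \<xi> :: "'a \<Rightarrow> complex"
  assume fin: "finite E" "finite F"
  have "(\<Sum>y\<in>F. \<xi> y * (c * a x y)) = c * (\<Sum>y\<in>F. \<xi> y * a x y)" for x
    by (simp add: sum_distrib_left mult.left_commute)
  then have "L2_set (\<lambda>x. cmod (\<Sum>y\<in>F. \<xi> y * (c * a x y))) E
      = cmod c * L2_set (\<lambda>x. cmod (\<Sum>y\<in>F. \<xi> y * a x y)) E"
    by (simp add: norm_mult L2_set_right_distrib)
  also have "\<dots> \<le> cmod c * (M * L2_set (\<lambda>y. cmod (\<xi> y)) F)"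
    by (intro mult_left_mono matrix_boundD[OF assms fin]) auto
  finally show "L2_set (\<lambda>x. cmod (\<Sum>y\<in>F. \<xi> y * (c * a x y))) E
      \<le> cmod c * M * L2_set (\<lambda>y. cmod (\<xi> y)) F"
    by (simp add: mult.assoc)
qed

lemma matrix_bound_add:
  assumes "matrix_bound M a" "matrix_bound N b"
  shows "matrix_bound (M + N) (\<lambda>x y. a x y + b x y)"
proof (rule matrix_boundI)
  fix E F :: "'a set" and \<xi> :: "'a \<Rightarrow> complex"
  assume fin: "finite E" "finite F"
  have "L2_set (\<lambda>x. cmod (\<Sum>y\<in>F. \<xi> y * (a x y + b x y))) E
      \<le> L2_set (\<lambda>x. cmod (\<Sum>y\<in>F. \<xi> y * a x y) + cmod (\<Sum>y\<in>F. \<xi> y * b x y)) E"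
    by (intro L2_set_mono) (auto simp: distrib_left sum.distrib norm_triangle_ineq)
  also have "\<dots> \<le> L2_set (\<lambda>x. cmod (\<Sum>y\<in>F. \<xi> y * a x y)) E
      + L2_set (\<lambda>x. cmod (\<Sum>y\<in>F. \<xi> y * b x y)) E"
    by (rule L2_set_triangle_ineq)
  also have "\<dots> \<le> (M + N) * L2_set (\<lambda>y. cmod (\<xi> y)) F"
    unfolding distrib_right by (intro add_mono matrix_boundD assms fin)
  finally show "L2_set (\<lambda>x. cmod (\<Sum>y\<in>F. \<xi> y * (a x y + b x y))) E
      \<le> (M + N) * L2_set (\<lambda>y. cmod (\<xi> y)) F" .
qed

text \<open>Conjugation moves from the matrix to the vector, where it changes no modulus.\<close>

lemma matrix_bound_cnj:
  assumes "matrix_bound M a"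
  shows "matrix_bound M (\<lambda>x y. cnj (a x y))"
proof (rule matrix_boundI)
  fix E F :: "'a set" and \<xi> :: "'a \<Rightarrow> complex"
  assume fin: "finite E" "finite F"
  have "cmod (\<Sum>y\<in>F. \<xi> y * cnj (a x y)) = cmod (\<Sum>y\<in>F. cnj (\<xi> y) * a x y)" for x
    by (subst complex_mod_cnj[symmetric]) simp
  then show "L2_set (\<lambda>x. cmod (\<Sum>y\<in>F. \<xi> y * cnj (a x y))) E \<le> M * L2_set (\<lambda>y. cmod (\<xi> y)) F"
    using matrix_boundD[OF assms fin, of "\<lambda>y. cnj (\<xi> y)"] by simp
qed

text \<open>Duality: pairing the output \<open>b\<close> with itself and exchanging the sums brings
  in the original block applied to the conjugate of \<open>b\<close>. Cauchy-Schwarz then bounds the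
  square of \<open>s\<close> by \<open>M * s\<close> times the norm of \<xi>.\<close>

lemma matrix_bound_transpose:
  assumes a: "matrix_bound M a"
  shows "matrix_bound M (\<lambda>x y. a y x)"
proof (rule matrix_boundI)
  fix E F :: "'a set" and \<xi> :: "'a \<Rightarrow> complex"
  assume fin: "finite E" "finite F"
  define b where "b x = (\<Sum>y\<in>F. \<xi> y * a y x)" for x
  define s where "s = L2_set (\<lambda>x. cmod (b x)) E"
  have "complex_of_real (s\<^sup>2) = (\<Sum>x\<in>E. b x * cnj (b x))"
    by (simp add: s_def L2_set_def sum_nonneg complex_norm_square[symmetric])
  also have "\<dots> = (\<Sum>x\<in>E. \<Sum>y\<in>F. \<xi> y * (cnj (b x) * a y x))"
    by (simp add: b_def sum_distrib_right mult_ac)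
  also have "\<dots> = (\<Sum>y\<in>F. \<xi> y * (\<Sum>x\<in>E. cnj (b x) * a y x))"
    by (subst sum.swap) (simp add: sum_distrib_left)
  finally have "s\<^sup>2 = cmod (\<Sum>y\<in>F. \<xi> y * (\<Sum>x\<in>E. cnj (b x) * a y x))"
    by (metis norm_of_real abs_power2)
  also have "\<dots> \<le> (\<Sum>y\<in>F. \<bar>cmod (\<xi> y)\<bar> * \<bar>cmod (\<Sum>x\<in>E. cnj (b x) * a y x)\<bar>)"
    by (rule order_trans[OF norm_sum]) (simp add: norm_mult)
  also have "\<dots> \<le> L2_set (\<lambda>y. cmod (\<xi> y)) F * L2_set (\<lambda>y. cmod (\<Sum>x\<in>E. cnj (b x) * a y x)) F"
    by (rule L2_set_mult_ineq)
  also have "\<dots> \<le> L2_set (\<lambda>y. cmod (\<xi> y)) F * (M * s)"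
    using matrix_boundD[OF a fin(2,1), of "\<lambda>x. cnj (b x)"]
    by (intro mult_left_mono) (auto simp: s_def)
  finally have "s * s \<le> (M * L2_set (\<lambda>y. cmod (\<xi> y)) F) * s"
    by (simp add: power2_eq_square mult_ac)
  moreover have "s \<ge> 0"
    by (simp add: s_def)
  \<comment> \<open>One factor \<open>s\<close> is cancelled; if \<open>s = 0\<close>, the claim is
    that the right-hand side is nonnegative.\<close>
  ultimately have "s \<le> M * L2_set (\<lambda>y. cmod (\<xi> y)) F"
    using matrix_bound_nonneg[OF a]
    by (cases "s = 0") (auto simp: mult_le_cancel_right)
  then show "L2_set (\<lambda>x. cmod (\<Sum>y\<in>F. \<xi> y * a y x)) E \<le> M * L2_set (\<lambda>y. cmod (\<xi> y)) F"
    by (simp add: s_def b_def)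
qed

text \<open>Matrix units serve as test matrices: a multiplier applied to one isolates a single value
  of its symbol.\<close>

lemma matrix_bound_unit:
  "matrix_bound 1 (\<lambda>x y. if x = g \<and> y = h then 1 else 0)"
proof (rule matrix_boundI)
  fix E F :: "'a set" and \<xi> :: "'a \<Rightarrow> complex"
  assume fin: "finite E" "finite F"
  define c where "c = (if h \<in> F then \<xi> h else 0)"
  have "(\<Sum>y\<in>F. \<xi> y * (if x = g \<and> y = h then 1 else 0)) = (if x = g then c else 0)" for x
    using fin by (cases "x = g") (simp_all add: c_def if_distrib cong: if_cong)
  then have "L2_set (\<lambda>x. cmod (\<Sum>y\<in>F. \<xi> y * (if x = g \<and> y = h then 1 else 0))) E
      = L2_set (\<lambda>x. if x = g then cmod c else 0) E"
    by (intro L2_set_cong) auto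
  also have "\<dots> \<le> (\<Sum>x\<in>E. if x = g then cmod c else 0)"
    by (rule L2_set_le_sum) auto
  also have "\<dots> \<le> cmod c"
    using fin by simp
  also have "\<dots> \<le> L2_set (\<lambda>y. cmod (\<xi> y)) F"
    using fin member_le_L2_set[of F h "\<lambda>y. cmod (\<xi> y)"] by (simp add: c_def)
  finally show "L2_set (\<lambda>x. cmod (\<Sum>y\<in>F. \<xi> y * (if x = g \<and> y = h then 1 else 0))) E
      \<le> 1 * L2_set (\<lambda>y. cmod (\<xi> y)) F"
    by simp
qed

text \<open>Each block inequality involves finitely many entries and therefore passes to entrywise
  limits.\<close>

lemma matrix_bound_tendsto:
  fixes a :: "'a \<Rightarrow> 'a \<Rightarrow> complex"
  assumes "\<forall>\<^sub>F i in net. matrix_bound M (b i)" "net \<noteq> bot"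
    and lim: "\<And>x y. ((\<lambda>i. b i x y) \<longlongrightarrow> a x y) net"
  shows "matrix_bound M a"
proof (rule matrix_boundI)
  fix E F :: "'a set" and \<xi> :: "'a \<Rightarrow> complex"
  assume fin: "finite E" "finite F"
  show "L2_set (\<lambda>x. cmod (\<Sum>y\<in>F. \<xi> y * a x y)) E \<le> M * L2_set (\<lambda>y. cmod (\<xi> y)) F"
  proof (rule tendsto_upperbound)
    show "((\<lambda>i. L2_set (\<lambda>x. cmod (\<Sum>y\<in>F. \<xi> y * b i x y)) E)
        \<longlongrightarrow> L2_set (\<lambda>x. cmod (\<Sum>y\<in>F. \<xi> y * a x y)) E) net"
      unfolding L2_set_def by (intro tendsto_intros lim)
    show "\<forall>\<^sub>F i in net. L2_set (\<lambda>x. cmod (\<Sum>y\<in>F. \<xi> y * b i x y)) E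
        \<le> M * L2_set (\<lambda>y. cmod (\<xi> y)) F"
      using assms(1) by eventually_elim (rule matrix_boundD[OF _ fin])
  qed fact
qed

subsection \<open>Contractive Herz-Schur multipliers\<close>

text \<open>Continuity is left out so that the class is closed under pointwise limits; it is
  restored in \<open>schur_contraction_imp_B2\<close>.\<close>

definition schur_contraction :: "('a::group_add \<Rightarrow> complex) \<Rightarrow> bool" where
  "schur_contraction u \<longleftrightarrow> (\<forall>M a. matrix_bound M a \<longrightarrow> matrix_bound M (schur_product u a))"

lemma schur_contractionI:
  "(\<And>M a. matrix_bound M a \<Longrightarrow> matrix_bound M (schur_product u a)) \<Longrightarrow> schur_contraction u"
  by (simp add: schur_contraction_def)

lemma schur_contractionD:
  "schur_contraction u \<Longrightarrow> matrix_bound M a \<Longrightarrow> matrix_bound M (schur_product u a)"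
  by (simp add: schur_contraction_def)

text \<open>After scaling to bound 1 the matrix represents a contraction, so the norm of its Schur
  product is among the values whose supremum is \<open>B2_norm u\<close>.\<close>

lemma B2_norm_le_imp_schur_contraction:
  assumes u: "u \<in> B2" "B2_norm u \<le> ereal C" and C: "C > 0"
  shows "schur_contraction (\<lambda>g. u g / complex_of_real C)"
proof (rule schur_contractionI)
  fix M and a :: "'a \<Rightarrow> 'a \<Rightarrow> complex" assume a: "matrix_bound M a"
  show "matrix_bound M (schur_product (\<lambda>g. u g / complex_of_real C) a)"
  proof (cases "M = 0")
    \<comment> \<open>The scaling divides by \<open>M\<close>, so \<open>M = 0\<close> is separate:
      all entries vanish.\<close>
    case True
    then have "a = (\<lambda>x y. 0)"
      using matrix_bound_entry[OF a] by (auto simp: fun_eq_iff)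
    then show ?thesis
      using a by (simp add: schur_product_def)
  next
    case False
    then have M: "M > 0"
      using matrix_bound_nonneg[OF a] by simp
    define b where "b = (\<lambda>x y. complex_of_real (1 / M) * a x y)"
    have b: "matrix_bound 1 b"
      using matrix_bound_cmult[OF a, of "complex_of_real (1 / M)"] M
      unfolding b_def norm_of_real by simp
    then obtain T where T: "represents b T"
      using matrix_bound_represents by blast
    then obtain S where S: "represents (schur_product u b) S"
      using u(1) unfolding B2_def by blast
    have "ereal (operator_norm S) \<le> B2_norm u"
      unfolding B2_norm_def using T S operator_norm_le[OF T b] by (intro Sup_upper) blast
    then have "operator_norm S \<le> C"
      using u(2) by (metis ereal_less_eq(3) order_trans)
    then have "matrix_bound C (schur_product u b)"
      by (rule matrix_bound_mono[OF matrix_bound_representation[OF S]])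
    \<comment> \<open>The factor \<open>M / C\<close> undoes the scaling by \<open>M\<close> and
      contributes the division of \<open>u\<close> by \<open>C\<close>.\<close>
    from matrix_bound_cmult[OF this, of "complex_of_real (M / C)"]
    have "matrix_bound M (\<lambda>x y. complex_of_real (M / C) * schur_product u b x y)"
      using M C unfolding norm_of_real by simp
    also have "(\<lambda>x y. complex_of_real (M / C) * schur_product u b x y)
        = schur_product (\<lambda>g. u g / complex_of_real C) a"
      using M C by (simp add: schur_product_def b_def fun_eq_iff)
    finally show ?thesis .
  qed
qed

text \<open>Contractivity is applied with \<open>operator_norm T\<close> as the block bound, which
  gives both a representing operator and its norm estimate.\<close>

lemma schur_contraction_imp_B2:
  fixes u :: "'a::topological_group_add \<Rightarrow> complex"
  assumes u: "schur_contraction u" and cont: "continuous_on UNIV u"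
  shows "u \<in> B2" and "B2_norm u \<le> 1"
proof -
  show "u \<in> B2"
    unfolding B2_def
    using cont matrix_bound_represents[OF schur_contractionD[OF u matrix_bound_representation]]
    by blast
  show "B2_norm u \<le> 1"
    unfolding B2_norm_def
  proof (rule Sup_least, clarify)
    fix a T S
    assume *: "represents a T" "operator_norm T \<le> 1" "represents (schur_product u a) S"
    have "operator_norm S \<le> operator_norm T"
      by (rule operator_norm_le[OF *(3) schur_contractionD[OF u matrix_bound_representation[OF *(1)]]])
    then show "ereal (operator_norm S) \<le> 1"
      using *(2) by simp
  qed
qed

text \<open>The matrix unit at \<open>(g, 0)\<close> is multiplied by
  \<open>u (- 0 + g) = u g\<close>.\<close>

lemma schur_contraction_bound:
  assumes "schur_contraction u"
  shows "cmod (u g) \<le> 1"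
  using matrix_bound_entry[OF schur_contractionD[OF assms matrix_bound_unit[of g 0]], of g 0]
  by (simp add: schur_product_def)

section \<open>Closure properties of contractive multipliers\<close>

lemma schur_contraction_one: "schur_contraction (\<lambda>_. 1)"
  by (rule schur_contractionI) (simp add: schur_product_def)

lemma schur_contraction_mult:
  assumes "schur_contraction u" "schur_contraction v"
  shows "schur_contraction (\<lambda>g. u g * v g)"
proof (rule schur_contractionI)
  fix M and a :: "'a \<Rightarrow> 'a \<Rightarrow> complex" assume "matrix_bound M a"
  then have "matrix_bound M (schur_product u (schur_product v a))"
    by (intro schur_contractionD assms)
  then show "matrix_bound M (schur_product (\<lambda>g. u g * v g) a)"
    by (simp add: schur_product_def mult.assoc)
qed

lemma schur_contraction_power:
  "schur_contraction u \<Longrightarrow> schur_contraction (\<lambda>g. u g ^ n)"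
  by (induction n) (simp_all add: schur_contraction_one schur_contraction_mult)

lemma schur_contraction_prod:
  "(\<And>i. i \<in> I \<Longrightarrow> schur_contraction (u i)) \<Longrightarrow> schur_contraction (\<lambda>g. \<Prod>i\<in>I. u i g)"
  by (induction I rule: infinite_finite_induct)
     (simp_all add: schur_contraction_one schur_contraction_mult)

lemma schur_contraction_convex:
  assumes "schur_contraction u" "schur_contraction v" "0 \<le> p" "p \<le> 1"
  shows "schur_contraction (\<lambda>g. complex_of_real (1 - p) * u g + complex_of_real p * v g)"
proof (rule schur_contractionI)
  fix M and a :: "'a \<Rightarrow> 'a \<Rightarrow> complex" assume "matrix_bound M a"
  then have "matrix_bound (cmod (complex_of_real (1 - p)) * M + cmod (complex_of_real p) * M)
     (\<lambda>x y. complex_of_real (1 - p) * schur_product u a x y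
            + complex_of_real p * schur_product v a x y)"
    by (intro matrix_bound_add matrix_bound_cmult schur_contractionD assms)
  also have "cmod (complex_of_real (1 - p)) * M + cmod (complex_of_real p) * M = M"
    using assms(3,4) unfolding norm_of_real by (simp add: algebra_simps)
  finally show "matrix_bound M
      (schur_product (\<lambda>g. complex_of_real (1 - p) * u g + complex_of_real p * v g) a)"
    by (simp add: schur_product_def algebra_simps)
qed

lemma schur_contraction_cnj:
  assumes "schur_contraction u"
  shows "schur_contraction (\<lambda>g. cnj (u g))"
proof (rule schur_contractionI)
  fix M and a :: "'a \<Rightarrow> 'a \<Rightarrow> complex" assume "matrix_bound M a"
  then have "matrix_bound M (\<lambda>x y. cnj (schur_product u (\<lambda>x y. cnj (a x y)) x y))"
    by (intro matrix_bound_cnj schur_contractionD assms)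
  then show "matrix_bound M (schur_product (\<lambda>g. cnj (u g)) a)"
    by (simp add: schur_product_def)
qed

text \<open>Transpose, multiply by \<open>u\<close>, transpose back: the factor at
  \<open>(x, y)\<close> becomes \<open>u (- x + y)\<close>, and \<open>- x + y\<close> is the
  negative of \<open>- y + x\<close>.\<close>

lemma schur_contraction_inverse:
  assumes "schur_contraction u"
  shows "schur_contraction (\<lambda>g. u (- g))"
proof (rule schur_contractionI)
  fix M and a :: "'a \<Rightarrow> 'a \<Rightarrow> complex" assume "matrix_bound M a"
  then have "matrix_bound M (\<lambda>x y. schur_product u (\<lambda>x y. a y x) y x)"
    by (rule matrix_bound_transpose[OF schur_contractionD[OF assms matrix_bound_transpose]])
  then show "matrix_bound M (schur_product (\<lambda>g. u (- g)) a)"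
    by (simp add: schur_product_def minus_add)
qed

lemma schur_contraction_tendsto:
  fixes v :: "'a::group_add \<Rightarrow> complex"
  assumes "\<forall>\<^sub>F i in net. schur_contraction (u i)" "net \<noteq> bot"
    and lim: "\<And>g. ((\<lambda>i. u i g) \<longlongrightarrow> v g) net"
  shows "schur_contraction v"
proof (rule schur_contractionI, rule matrix_bound_tendsto)
  fix M and a :: "'a \<Rightarrow> 'a \<Rightarrow> complex" assume "matrix_bound M a"
  with assms(1) show "\<forall>\<^sub>F i in net. matrix_bound M (schur_product (u i) a)"
    by (auto elim!: eventually_mono dest: schur_contractionD)
  show "((\<lambda>i. schur_product (u i) a x y) \<longlongrightarrow> schur_product v a x y) net" for x y
    unfolding schur_product_def by (intro tendsto_intros lim)
qed (rule assms(2))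

lemma schur_contraction_exp:
  assumes v: "schur_contraction (\<lambda>g. complex_of_real (v g))" and t: "t \<ge> 0"
  shows "schur_contraction (\<lambda>g. complex_of_real (exp (- t * (1 - v g))))"
proof (rule schur_contraction_tendsto)
  let ?p = "\<lambda>n g. 1 + (- t * (1 - v g)) / real n"
  show "(\<lambda>n. complex_of_real (?p n g ^ n)) \<longlonglongrightarrow> complex_of_real (exp (- t * (1 - v g)))" for g
    by (intro tendsto_of_real tendsto_exp_limit_sequentially)
  show "\<forall>\<^sub>F n in sequentially. schur_contraction (\<lambda>g. complex_of_real (?p n g ^ n))"
    \<comment> \<open>From \<open>n \<ge> t\<close> on, \<open>t / n\<close> is at most 1, so the
      base of the power is a convex combination of 1 and \<open>v\<close>.\<close>
    using eventually_ge_at_top[of "nat \<lceil>t\<rceil>"] eventually_gt_at_top[of 0]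
  proof eventually_elim
    case (elim n)
    have "schur_contraction (\<lambda>g. complex_of_real (1 - t / n) * 1
        + complex_of_real (t / n) * complex_of_real (v g))"
      using elim t by (intro schur_contraction_convex schur_contraction_one v) (auto simp: field_simps)
    also have "(\<lambda>g. complex_of_real (1 - t / n) * 1
        + complex_of_real (t / n) * complex_of_real (v g)) = (\<lambda>g. complex_of_real (?p n g))"
      using elim by (auto simp: fun_eq_iff field_simps)
    finally show ?case
      unfolding of_real_power by (rule schur_contraction_power)
  qed
qed simp

subsection \<open>The weak Haagerup constant\<close>

text \<open>Contractivity after division by \<open>C\<close> gives
  \<open>cmod (u 0) \<le> C\<close>, whereas \<open>u 0\<close> comes arbitrarily close to
  1.\<close>

lemma WH_constants_ge_1:
  assumes "C \<in> WH_constants TYPE('a::topological_group_add)"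
  shows "C \<ge> 1"
proof (rule field_le_epsilon)
  fix e :: real assume "e > 0"
  obtain F :: "('a \<Rightarrow> complex) filter" where C: "C > 0" and "F \<noteq> bot"
    and F: "\<forall>\<^sub>F u in F. u \<in> B2 \<inter> C0 \<and> B2_norm u \<le> ereal C"
    and lim: "\<And>K. compact K \<Longrightarrow> uniform_limit K (\<lambda>u. u) (\<lambda>_. 1) F"
    using assms unfolding WH_constants_def by blast
  have "\<forall>\<^sub>F u in F. \<forall>x\<in>{0}. dist (u x) 1 < e"
    using lim[of "{0}"] \<open>e > 0\<close> unfolding uniform_limit_iff by simp
  from eventually_happens'[OF \<open>F \<noteq> bot\<close> eventually_conj[OF F this]]
  obtain u :: "'a \<Rightarrow> complex" where u: "u \<in> B2" "B2_norm u \<le> ereal C" "cmod (1 - u 0) < e"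
    by (auto simp: dist_norm norm_minus_commute)
  have "cmod (u 0 / complex_of_real C) \<le> 1"
    by (rule schur_contraction_bound[OF B2_norm_le_imp_schur_contraction[OF u(1,2) C]])
  then have "cmod (u 0) \<le> C"
    using C by (simp add: norm_divide)
  then show "1 \<le> C + e"
    using norm_triangle_sub[of 1 "u 0"] u(3) by simp
qed

text \<open>An admissible \<open>C\<close> below \<open>1 + e / 2\<close> is chosen and the
  approximant is divided by it; the approximation and the division each cost less than
  \<open>e / 2\<close>.\<close>

lemma Lambda_WH_1_approximation:
  assumes L: "Lambda_WH TYPE('a::topological_group_add) = 1" and "compact K" and "e > 0"
  obtains w :: "'a::topological_group_add \<Rightarrow> complex" where "w \<in> C0" "schur_contraction w"
    "\<And>g. g \<in> K \<Longrightarrow> cmod (w g - 1) < e"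
proof -
  have "Lambda_WH TYPE('a) < ereal (1 + e / 2)"
    using L \<open>e > 0\<close> by simp
  then obtain C where WH: "C \<in> WH_constants TYPE('a)" and less: "C < 1 + e / 2"
    unfolding Lambda_WH_def Inf_less_iff by auto
  obtain F :: "('a \<Rightarrow> complex) filter" where C: "C > 0" and "F \<noteq> bot"
    and F: "\<forall>\<^sub>F u in F. u \<in> B2 \<inter> C0 \<and> B2_norm u \<le> ereal C"
    and lim: "\<And>K. compact K \<Longrightarrow> uniform_limit K (\<lambda>u. u) (\<lambda>_. 1) F"
    using WH unfolding WH_constants_def by blast
  have "\<forall>\<^sub>F u in F. \<forall>x\<in>K. dist (u x) 1 < e / 2"
    using lim[OF \<open>compact K\<close>] \<open>e > 0\<close> unfolding uniform_limit_iff by (meson half_gt_zero)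
  from eventually_happens'[OF \<open>F \<noteq> bot\<close> eventually_conj[OF F this]]
  obtain u :: "'a \<Rightarrow> complex" where u: "u \<in> B2" "u \<in> C0" "B2_norm u \<le> ereal C"
    and near: "\<And>g. g \<in> K \<Longrightarrow> cmod (u g - 1) < e / 2"
    by (auto simp: dist_norm)
  have C1: "C \<ge> 1" by (rule WH_constants_ge_1[OF WH])
  \<comment> \<open>Division by \<open>C \<ge> 1\<close> decreases moduli; this preserves decay at
    infinity and controls both error terms.\<close>
  have shrink: "cmod (z / complex_of_real C) \<le> cmod z" for z
    using C1 mult_left_mono[of 1 C "cmod z"] by (simp add: norm_divide field_simps)
  show thesis
  proof
    show "(\<lambda>g. u g / complex_of_real C) \<in> C0"
      using u(2) C shrink unfolding C0_def
      by (auto intro!: continuous_intros) (meson order_le_less_trans)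
    show "schur_contraction (\<lambda>g. u g / complex_of_real C)"
      by (rule B2_norm_le_imp_schur_contraction[OF u(1,3) C])
    fix g assume "g \<in> K"
    have "u g / complex_of_real C - 1
        = (u g - 1) / complex_of_real C + complex_of_real (1 - C) / complex_of_real C"
      using C by (simp add: field_simps)
    also have "cmod \<dots> \<le> cmod (u g - 1) + cmod (complex_of_real (1 - C))"
      by (intro order_trans[OF norm_triangle_ineq] add_mono shrink)
    also have "\<dots> < e / 2 + e / 2"
      using near[OF \<open>g \<in> K\<close>] C1 less by (intro add_strict_mono) (auto simp del: of_real_diff)
    finally show "cmod (u g / complex_of_real C - 1) < e" by simp
  qed
qed

text \<open>Multiplying \<open>w\<close> by its conjugate and by both functions at the inverse
  argument makes it nonnegative and symmetric within the contractive multipliers.\<close>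

lemma Lambda_WH_1_symmetric_approximation:
  assumes L: "Lambda_WH TYPE('a::topological_group_add) = 1" and K: "compact K" and "e > 0"
  shows "\<exists>v :: 'a::topological_group_add \<Rightarrow> real. continuous_on UNIV v \<and> schur_contraction (\<lambda>g. complex_of_real (v g)) \<and>
    (\<forall>g. 0 \<le> v g \<and> v g \<le> 1 \<and> v (- g) = v g) \<and> (\<forall>g\<in>K. 1 - v g < e) \<and>
    (\<exists>L. compact L \<and> (\<forall>g. g \<notin> L \<longrightarrow> v g < 1 / 2))"
proof -
  \<comment> \<open>The set is symmetrized because \<open>v g\<close> involves both
    \<open>w g\<close> and \<open>w (- g)\<close>.\<close>
  have K': "compact (K \<union> uminus ` K)"
    by (intro compact_Un K compact_continuous_image continuous_intros)
  obtain w :: "'a \<Rightarrow> complex" where w: "w \<in> C0" "schur_contraction w"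
    and near: "\<And>g. g \<in> K \<union> uminus ` K \<Longrightarrow> cmod (w g - 1) < e / 4"
    using Lambda_WH_1_approximation[OF L K', of "e / 4"] \<open>e > 0\<close> by auto
  define v where "v g = (cmod (w g))\<^sup>2 * (cmod (w (- g)))\<^sup>2" for g
  have cont: "continuous_on UNIV w"
    using w(1) by (simp add: C0_def)
  have w1: "cmod (w g) \<le> 1" for g
    by (rule schur_contraction_bound[OF w(2)])
  have "continuous_on UNIV v"
    unfolding v_def
    by (intro continuous_intros cont continuous_on_compose2[OF cont]) auto
  moreover have "schur_contraction (\<lambda>g. w g * cnj (w g) * (w (- g) * cnj (w (- g))))"
    by (intro schur_contraction_mult schur_contraction_cnj schur_contraction_inverse w
        schur_contraction_inverse[of "\<lambda>g. cnj (w g)"])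
  then have "schur_contraction (\<lambda>g. complex_of_real (v g))"
    by (simp only: v_def complex_norm_square of_real_mult)
  moreover have "0 \<le> v g \<and> v g \<le> 1 \<and> v (- g) = v g" for g
    using w1 by (auto simp: v_def power_le_one mult_le_one mult.commute)
  moreover have "1 - v g < e" if "g \<in> K" for g
  proof -
    \<comment> \<open>The defects \<open>p\<close> and \<open>q\<close> are below
      \<open>e / 4\<close>, and the final estimate is
      \<open>1 - v g \<le> 2 * p + 2 * q\<close>.\<close>
    define p q where "p = 1 - cmod (w g)" and "q = 1 - cmod (w (- g))"
    have pq: "0 \<le> p" "p < e / 4" "0 \<le> q" "q < e / 4" "p \<le> 1" "q \<le> 1"
      using near[of g] near[of "- g"] w1[of g] w1[of "- g"] that
        norm_triangle_ineq2[of 1 "w g"] norm_triangle_ineq2[of 1 "w (- g)"]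
      by (auto simp: p_def q_def norm_minus_commute)
    have "p\<^sup>2 \<le> p" "q\<^sup>2 \<le> q"
      using pq by (auto simp: power2_eq_square mult_left_le)
    with pq have "1 - 2 * p \<le> (1 - p)\<^sup>2" "1 - 2 * q \<le> (1 - q)\<^sup>2" "(1 - p)\<^sup>2 \<le> 1" "(1 - q)\<^sup>2 \<le> 1"
      by (auto simp: power2_diff)
    \<comment> \<open>Expanding this product bounds the defect of a product by the sum of the
      defects of its factors.\<close>
    moreover have "0 \<le> (1 - (1 - p)\<^sup>2) * (1 - (1 - q)\<^sup>2)"
      using calculation by (intro mult_nonneg_nonneg) auto
    ultimately have "1 - (1 - p)\<^sup>2 * (1 - q)\<^sup>2 \<le> 2 * p + 2 * q"
      by (simp add: algebra_simps)
    then show ?thesis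
      using pq by (simp add: v_def p_def q_def)
  qed
  moreover obtain L where "compact L" "\<And>g. g \<notin> L \<Longrightarrow> cmod (w g) < 1 / 2"
    using w(1) unfolding C0_def by (auto dest!: spec[of _ "1 / 2"])
  moreover have "v g \<le> cmod (w g)" for g
  proof -
    have "v g \<le> (cmod (w g))\<^sup>2"
      using w1[of "- g"] by (simp add: v_def mult_left_le power_le_one)
    also have "\<dots> \<le> cmod (w g)"
      using w1[of g] by (simp add: power2_eq_square mult_left_le)
    finally show ?thesis .
  qed
  ultimately show ?thesis
    by (meson order_le_less_trans)
qed

section \<open>Compact exhaustion and the construction of \<psi>\<close>

text \<open>Local compactness puts an open set with compact cover around each \<open>K n\<close>;
  finite unions make the covers increasing. The open sets are what later turns uniform convergence
  into continuity on the whole group.\<close>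

lemma compact_exhaustion:
  assumes lc: "locally_compact_space (euclidean :: 'a::t2_space topology)"
    and "sigma_compact (UNIV :: 'a::t2_space set)"
  obtains U L :: "nat \<Rightarrow> 'a::t2_space set" where "\<And>n. open (U n)" "\<And>n. compact (L n)"
    "\<And>n. U n \<subseteq> L n" "\<And>n. L n \<subseteq> L (Suc n)" "(\<Union>n. U n) = UNIV"
proof -
  obtain K :: "nat \<Rightarrow> 'a set" where K: "\<And>n. compact (K n)" "(\<Union>n. K n) = UNIV"
    using assms(2) unfolding sigma_compact_def by blast
  have "Hausdorff_space (euclidean :: 'a topology)"
    unfolding Hausdorff_space_def disjnt_def by simp (meson hausdorff)
  then have "\<forall>K. compactin euclidean K \<longrightarrow> (\<exists>V M. openin euclidean V \<and>
      compactin euclidean M \<and> closedin euclidean M \<and> K \<subseteq> V \<and> V \<subseteq> (M :: 'a set))"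
    using lc locally_compact_space_compact_closed_compact by blast
  then have "\<exists>V M. open V \<and> compact M \<and> K n \<subseteq> V \<and> V \<subseteq> M" for n
    using K(1)[of n] by (simp flip: open_openin) meson
  then obtain V M where VM: "\<And>n. open (V n)" "\<And>n. compact (M n)" "\<And>n. K n \<subseteq> V n" "\<And>n. V n \<subseteq> M n"
    by metis
  show thesis
  proof
    show "open (V n)" for n by (rule VM)
    show "compact (\<Union>i\<le>n. M i)" for n using VM by auto
    show "V n \<subseteq> (\<Union>i\<le>n. M i)" for n using VM(4)[of n] by auto
    show "(\<Union>i\<le>n. M i) \<subseteq> (\<Union>i\<le>Suc n. M i)" for n by (auto simp: atMost_Suc)
    have "(\<Union>n. K n) \<subseteq> (\<Union>n. V n)"
      by (intro UN_mono VM(3)) auto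
    then show "(\<Union>n. V n) = UNIV"
      using K(2) by auto
  qed
qed

lemma Lambda_WH_1_imp_proper:
  assumes lc: "locally_compact_space (euclidean :: 'a::{topological_group_add, t2_space} topology)"
    and \<sigma>c: "sigma_compact (UNIV :: 'a::{topological_group_add, t2_space} set)"
    and \<Lambda>: "Lambda_WH TYPE('a::{topological_group_add, t2_space}) = 1"
  obtains \<psi> :: "'a::{topological_group_add, t2_space} \<Rightarrow> real" where "continuous_on UNIV \<psi>" "proper_function \<psi>"
    "\<And>g. \<psi> g \<ge> 0" "\<And>g. \<psi> (- g) = \<psi> g"
    "\<And>t. t > 0 \<Longrightarrow> schur_contraction (\<lambda>g. complex_of_real (exp (- t * \<psi> g)))"
proof -
  obtain U L :: "nat \<Rightarrow> 'a set" where U: "\<And>n. open (U n)" and L: "\<And>n. compact (L n)"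
    and UL: "\<And>n. U n \<subseteq> L n" and inc: "\<And>n. L n \<subseteq> L (Suc n)" and UU: "(\<Union>n. U n) = UNIV"
    using compact_exhaustion[OF lc \<sigma>c] by metis
  have "\<forall>n. \<exists>v :: 'a \<Rightarrow> real. continuous_on UNIV v \<and>
    schur_contraction (\<lambda>g. complex_of_real (v g)) \<and>
    (\<forall>g. 0 \<le> v g \<and> v g \<le> 1 \<and> v (- g) = v g) \<and> (\<forall>g\<in>L n. 1 - v g < (1 / 2) ^ n) \<and>
    (\<exists>L. compact L \<and> (\<forall>g. g \<notin> L \<longrightarrow> v g < 1 / 2))"
    by (intro allI Lambda_WH_1_symmetric_approximation[OF \<Lambda> L]) simp
  then obtain v :: "nat \<Rightarrow> 'a \<Rightarrow> real" where
    "\<forall>n. continuous_on UNIV (v n) \<and> schur_contraction (\<lambda>g. complex_of_real (v n g)) \<and>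
    (\<forall>g. 0 \<le> v n g \<and> v n g \<le> 1 \<and> v n (- g) = v n g) \<and> (\<forall>g\<in>L n. 1 - v n g < (1 / 2) ^ n) \<and>
    (\<exists>L. compact L \<and> (\<forall>g. g \<notin> L \<longrightarrow> v n g < 1 / 2))"
    by (rule choice[THEN exE])
  then have v: "\<And>n. continuous_on UNIV (v n)"
      "\<And>n. schur_contraction (\<lambda>g. complex_of_real (v n g))"
    and v01: "\<And>n g. 0 \<le> v n g" "\<And>n g. v n g \<le> 1"
    and sym: "\<And>n g. v n (- g) = v n g"
    and near: "\<And>n g. g \<in> L n \<Longrightarrow> 1 - v n g < (1 / 2) ^ n"
    and "\<forall>n. \<exists>M. compact M \<and> (\<forall>g. g \<notin> M \<longrightarrow> v n g < 1 / 2)"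
    by blast+
  then obtain M where M: "\<And>n. compact (M n)" "\<And>n g. g \<notin> M n \<Longrightarrow> v n g < 1 / 2"
    by metis
  have mono: "L m \<subseteq> L n" if "m \<le> n" for m n
    using inc that by (rule lift_Suc_mono_le)
  \<comment> \<open>The estimate on \<open>L n\<close> is inherited by the smaller
    \<open>L m\<close>; on \<open>U m\<close> the geometric bound thus holds from index
    \<open>m\<close> on, as the eventual form of the Weierstrass test requires.\<close>
  have bound: "norm (1 - v n g) \<le> (1 / 2) ^ n" if "g \<in> L m" "m \<le> n" for m n g
    using near[of g n] mono[OF that(2)] that(1) v01(2)[of n g] by auto
  define \<psi> where "\<psi> g = (\<Sum>n. 1 - v n g)" for g
  have unif: "uniform_limit (U m) (\<lambda>n g. \<Sum>i<n. 1 - v i g) \<psi> sequentially" for m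
    unfolding \<psi>_def
  proof (rule Weierstrass_m_test_ev)
    show "\<forall>\<^sub>F n in sequentially. \<forall>g\<in>U m. norm (1 - v n g) \<le> (1 / 2) ^ n"
      using eventually_ge_at_top[of m] by eventually_elim (use bound UL in blast)
  qed (simp add: summable_geometric)
  have summable: "summable (\<lambda>n. 1 - v n g)" for g
  proof -
    obtain m where "g \<in> U m" using UU by blast
    then have "\<exists>m. \<forall>n\<ge>m. norm (1 - v n g) \<le> (1 / 2) ^ n"
      using bound UL by blast
    then show ?thesis
      by (rule summable_comparison_test[of _ "\<lambda>n. (1 / 2) ^ n"]) (auto simp: summable_geometric)
  qed
  have nonneg: "\<psi> g \<ge> 0" for g
    unfolding \<psi>_def using v01(2) by (intro suminf_nonneg summable) simp
  have cont: "continuous_on UNIV \<psi>"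
  proof -
    have "continuous_on (U m) \<psi>" for m
    proof (rule uniform_limit_theorem[OF _ unif])
      show "\<forall>\<^sub>F n in sequentially. continuous_on (U m) (\<lambda>g. \<Sum>i<n. 1 - v i g)"
        by (intro always_eventually allI continuous_intros continuous_on_subset[OF v(1)]) auto
    qed simp
    then have "continuous_on (\<Union>m\<in>UNIV. U m) \<psi>"
      using U by (intro continuous_on_open_UN) auto
    then show ?thesis using UU by simp
  qed
  have proper: "proper_function \<psi>"
    unfolding proper_function_def
  proof (intro allI impI)
    fix C :: "real set" assume C: "compact C"
    then obtain c where c: "\<And>r. r \<in> C \<Longrightarrow> r \<le> c"
      using bounded_imp_bdd_above[OF compact_imp_bounded] by (metis bdd_above.E)
    \<comment> \<open>Outside the first \<open>N\<close> sets \<open>M n\<close>, each of the first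
      \<open>N\<close> terms of the series exceeds 1/2, so \<psi> is at least \<open>N / 2\<close>,
      which is above \<open>c\<close>.\<close>
    obtain N where "2 * c < real N"
      using reals_Archimedean2 by blast
    then have N: "c < real N / 2"
      by simp
    have "closed (\<psi> -` C)"
      using compact_imp_closed[OF C] cont by (rule closed_vimage)
    moreover have "\<psi> -` C \<subseteq> (\<Union>n<N. M n)"
    proof (rule ccontr)
      assume "\<not> \<psi> -` C \<subseteq> (\<Union>n<N. M n)"
      then obtain g where g: "\<psi> g \<in> C" "\<And>n. n < N \<Longrightarrow> g \<notin> M n" by auto
      have "real N / 2 = (\<Sum>n<N. 1 / 2)" by simp
      also have "\<dots> \<le> (\<Sum>n<N. 1 - v n g)"
        using M(2)[OF g(2)] by (intro sum_mono) (simp add: field_simps less_imp_le)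
      also have "\<dots> \<le> \<psi> g"
        unfolding \<psi>_def using v01(2) by (intro sum_le_suminf summable) auto
      also have "\<dots> \<le> c" using c g(1) .
      finally show False using N by simp
    qed
    moreover have "compact (\<Union>n<N. M n)" using M(1) by blast
    ultimately show "compact (\<psi> -` C)"
      by (metis compact_Int_closed inf.absorb2)
  qed
  show thesis
  proof (rule that[OF cont proper nonneg])
    show "\<psi> (- g) = \<psi> g" for g
      by (simp add: \<psi>_def sym)
    fix t :: real assume "t > 0"
    show "schur_contraction (\<lambda>g. complex_of_real (exp (- t * \<psi> g)))"
    \<comment> \<open>The partial sums of \<psi> turn into finite products of the multipliers from
      \<open>schur_contraction_exp\<close>.\<close>
    proof (rule schur_contraction_tendsto)
      show "\<forall>\<^sub>F n in sequentially. schur_contraction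
          (\<lambda>g. \<Prod>i<n. complex_of_real (exp (- t * (1 - v i g))))"
        using \<open>t > 0\<close>
        by (intro always_eventually allI schur_contraction_prod schur_contraction_exp v) simp
      fix g
      have "(\<lambda>n. complex_of_real (exp (- t * (\<Sum>i<n. 1 - v i g))))
          \<longlonglongrightarrow> complex_of_real (exp (- t * \<psi> g))"
        unfolding \<psi>_def by (intro tendsto_intros summable_LIMSEQ summable)
      then show "(\<lambda>n. \<Prod>i<n. complex_of_real (exp (- t * (1 - v i g))))
          \<longlonglongrightarrow> complex_of_real (exp (- t * \<psi> g))"
        by (simp add: sum_distrib_left exp_sum del: sum_subtractf)
    qed simp
  qed
qed

section \<open>From a proper function to the constant 1\<close>

lemma proper_imp_Lambda_WH_1:
  fixes \<psi> :: "'a::topological_group_add \<Rightarrow> real"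
  assumes cont: "continuous_on UNIV \<psi>" and proper: "proper_function \<psi>" and nonneg: "\<And>g. \<psi> g \<ge> 0"
    and B2: "\<And>t. t > 0 \<Longrightarrow> (\<lambda>g. complex_of_real (exp (- t * \<psi> g))) \<in> B2 \<and>
                     B2_norm (\<lambda>g. complex_of_real (exp (- t * \<psi> g))) \<le> 1"
  shows "Lambda_WH TYPE('a) = 1"
proof (rule antisym)
  show "1 \<le> Lambda_WH TYPE('a)"
    unfolding Lambda_WH_def by (rule Inf_greatest) (auto dest: WH_constants_ge_1)
  \<comment> \<open>The successor keeps the parameter strictly positive at
    \<open>n = 0\<close>.\<close>
  define s where "s n = 1 / real (Suc n)" for n
  have s: "s n > 0" for n by (simp add: s_def)
  have C0: "(\<lambda>g. complex_of_real (exp (- t * \<psi> g))) \<in> C0" if "t > 0" for t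
    unfolding C0_def
  proof (intro CollectI conjI allI impI)
    show "continuous_on UNIV (\<lambda>g. complex_of_real (exp (- t * \<psi> g)))"
      by (intro continuous_intros cont)
    fix e :: real assume "e > 0"
    \<comment> \<open>The threshold solves \<open>exp (- t * r) = e\<close> for \<open>r\<close>.
      When \<open>e > 1\<close> the interval is empty and the bound holds everywhere because \<psi>
      is nonnegative.\<close>
    have "cmod (complex_of_real (exp (- t * \<psi> g))) < e" if "g \<notin> \<psi> -` {0..- ln e / t}" for g
    proof -
      have "- ln e / t < \<psi> g" using that nonneg by auto
      then have "- t * \<psi> g < ln e" using \<open>t > 0\<close> by (simp add: field_simps)
      then show ?thesis using \<open>e > 0\<close> by (metis exp_less_cancel_iff exp_ln norm_of_real abs_exp_cancel)
    qed
    moreover have "compact (\<psi> -` {0..- ln e / t})"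
      using proper unfolding proper_function_def by blast
    ultimately show "\<exists>K. compact K \<and> (\<forall>g. g \<notin> K \<longrightarrow> cmod (complex_of_real (exp (- t * \<psi> g))) < e)"
      by blast
  qed
  have "1 \<in> WH_constants TYPE('a)"
  proof (rule WH_constantsI)
    show "directed_set (UNIV :: nat set) (\<le>)"
      unfolding directed_set_def by (auto intro: max.cobounded1 max.cobounded2)
    show "(\<lambda>g. complex_of_real (exp (- s n * \<psi> g))) \<in> B2 \<inter> C0 \<and>
        B2_norm (\<lambda>g. complex_of_real (exp (- s n * \<psi> g))) \<le> ereal 1" for n
      using B2[OF s] C0[OF s] by (simp add: one_ereal_def)
    fix K :: "'a set" and e :: real assume "compact K" "e > 0"
    then have "bdd_above (\<psi> ` K)"
      by (intro bounded_imp_bdd_above compact_imp_bounded compact_continuous_image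
          continuous_on_subset[OF cont]) auto
    then obtain c where c: "\<And>g. g \<in> K \<Longrightarrow> \<psi> g \<le> c" by (auto simp: bdd_above_def)
    \<comment> \<open>This choice makes \<open>s n * \<bar>c\<bar>\<close> smaller than
      \<open>e\<close> for all \<open>n \<ge> m\<close>, and that quantity dominates
      \<open>1 - exp (- s n * \<psi> g)\<close> on \<open>K\<close>.\<close>
    obtain m where m: "\<bar>c\<bar> / e < real m" using reals_Archimedean2 by blast
    have "cmod (complex_of_real (exp (- s n * \<psi> g)) - 1) < e" if "m \<le> n" "g \<in> K" for n g
    proof -
      have "1 - s n * \<psi> g \<le> exp (- s n * \<psi> g)" "exp (- s n * \<psi> g) \<le> 1"
        using exp_ge_add_one_self[of "- s n * \<psi> g"] s[of n] nonneg[of g] by auto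
      then have "cmod (complex_of_real (exp (- s n * \<psi> g) - 1)) \<le> s n * \<psi> g"
        unfolding norm_of_real by linarith
      also have "\<dots> \<le> s n * \<bar>c\<bar>"
        using s[of n] c[OF that(2)] by (intro mult_left_mono) auto
      also have "\<dots> < e"
      proof -
        have "\<bar>c\<bar> < real m * e" using m \<open>e > 0\<close> by (simp add: field_simps)
        also have "\<dots> \<le> real (Suc n) * e" using that \<open>e > 0\<close> by (intro mult_right_mono) auto
        finally show ?thesis by (simp add: s_def field_simps)
      qed
      finally show ?thesis by simp
    qed
    then show "\<exists>i\<in>UNIV. \<forall>j\<in>UNIV. i \<le> j \<longrightarrow> (\<forall>g\<in>K. cmod (complex_of_real (exp (- s j * \<psi> g)) - 1) < e)"
      by blast
  qed simp
  then show "Lambda_WH TYPE('a) \<le> 1"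
    unfolding Lambda_WH_def by (intro Inf_lower) (auto simp: one_ereal_def)
qed

theorem proposition4p4:
  assumes "locally_compact_space (euclidean :: 'a::{topological_group_add, t2_space} topology)"
    and "sigma_compact (UNIV :: 'a::{topological_group_add, t2_space} set)"
  shows "(Lambda_WH TYPE('a) = 1 \<longleftrightarrow>
           (\<exists>\<psi> :: 'a \<Rightarrow> real.
              continuous_on UNIV \<psi> \<and> proper_function \<psi> \<and> (\<forall>g. \<psi> g \<ge> 0) \<and>
              (\<forall>t>0. (\<lambda>g. complex_of_real (exp (- t * \<psi> g))) \<in> B2 \<and>
                     B2_norm (\<lambda>g. complex_of_real (exp (- t * \<psi> g))) \<le> 1))) \<and>
         (Lambda_WH TYPE('a) = 1 \<longrightarrow>
           (\<exists>\<psi> :: 'a \<Rightarrow> real.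
              continuous_on UNIV \<psi> \<and> proper_function \<psi> \<and> (\<forall>g. \<psi> g \<ge> 0) \<and>
              (\<forall>t>0. (\<lambda>g. complex_of_real (exp (- t * \<psi> g))) \<in> B2 \<and>
                     B2_norm (\<lambda>g. complex_of_real (exp (- t * \<psi> g))) \<le> 1) \<and>
              (\<forall>g. \<psi> (- g) = \<psi> g)))"
    (is "(_ \<longleftrightarrow> ?proper) \<and> (_ \<longrightarrow> ?symmetric)")
proof -
  \<comment> \<open>The symmetric version contains the plain one, so this implication and the
    converse from \<open>?proper\<close> yield both conjuncts.\<close>
  have "?symmetric" if "Lambda_WH TYPE('a) = 1"
  proof -
    obtain \<psi> :: "'a \<Rightarrow> real" where \<psi>: "continuous_on UNIV \<psi>" "proper_function \<psi>"
      "\<And>g. \<psi> g \<ge> 0" "\<And>g. \<psi> (- g) = \<psi> g"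
      "\<And>t. t > 0 \<Longrightarrow> schur_contraction (\<lambda>g. complex_of_real (exp (- t * \<psi> g)))"
      using Lambda_WH_1_imp_proper[OF assms \<open>Lambda_WH TYPE('a) = 1\<close>] by metis
    have "continuous_on UNIV (\<lambda>g. complex_of_real (exp (- t * \<psi> g)))" for t
      by (intro continuous_intros \<psi>)
    then show ?thesis
      using \<psi> schur_contraction_imp_B2[OF \<psi>(5)] by blast
  qed
  moreover have "Lambda_WH TYPE('a) = 1" if ?proper
    using that proper_imp_Lambda_WH_1 by blast
  ultimately show ?thesis
    by blast
qed

end
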